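(* Let $\mathcal{A}$ be a Leibniz algebra over a field $F$ of characteristic zero and let $B$ be a subalgebra of $\mathcal{A}$. Let $\underline{B}$ be the subalgebra of $B$ generated by all subinvariant subalgebras of $\mathcal{A}$ contained in $B$. Then $\underline{B}$ is an ideal of $B$.
   Context: A Leibniz algebra over a field $F$ means a finite-dimensional left Leibniz algebra: a finite-dimensional $F$-vector space with a bilinear product $(x,y)\mapsto xy$ such that $x(yz) = (xy)z + y(xz)$ for all $x,y,z$. Ideals are two-sided; $I \vartriangleleft J$ means $I$ is an ideal of $J$. A subalgebra $C$ of $\mathcal{A}$ is subinvariant in $\mathcal{A}$ if there is a chain of subalgebras $C = C_t \subset C_{t-1} \subset \cdots \subset C_0 = \mathcal{A}$ with $C_i \vartriangleleft C_{i-1}$ for all $1 \leq i \leq t$. *)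

theory Defs
  imports Complex_Main
begin

text \<open>
  The underlying vector space is the whole type \<open>'a\<close>; subalgebras, ideals etc. are subsets of it.
\<close>

locale leibniz_algebra = vector_space scale
  for scale :: "'f::field \<Rightarrow> 'a::ab_group_add \<Rightarrow> 'a" (infixr \<open>*s\<close> 75) +
  fixes mult :: "'a \<Rightarrow> 'a \<Rightarrow> 'a" (infixl \<open>\<bullet>\<close> 70)
  assumes finite_dimensional: "\<exists>X. finite X \<and> span X = UNIV"
    and linear_left: "\<And>y. Vector_Spaces.linear scale scale (\<lambda>x. x \<bullet> y)"
    and linear_right: "\<And>x. Vector_Spaces.linear scale scale (\<lambda>y. x \<bullet> y)"
    and leibniz: "\<And>x y z. x \<bullet> (y \<bullet> z) = (x \<bullet> y) \<bullet> z + y \<bullet> (x \<bullet> z)"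
begin

definition subalgebra :: "'a set \<Rightarrow> bool" where
  "subalgebra S \<longleftrightarrow> subspace S \<and> (\<forall>x\<in>S. \<forall>y\<in>S. x \<bullet> y \<in> S)"

definition ideal_of :: "'a set \<Rightarrow> 'a set \<Rightarrow> bool" (infix \<open>\<lhd>\<close> 50) where
  "I \<lhd> J \<longleftrightarrow> subalgebra J \<and> subspace I \<and> I \<subseteq> J \<and>
    (\<forall>x\<in>I. \<forall>y\<in>J. x \<bullet> y \<in> I \<and> y \<bullet> x \<in> I)"

text \<open>
  Inclusions in the chain are not required to be strict; repeated members can be deleted.
\<close>

definition subinvariant :: "'a set \<Rightarrow> bool" where
  "subinvariant C \<longleftrightarrow>
    (\<exists>(t::nat) (D :: nat \<Rightarrow> 'a set).
        D 0 = UNIV \<and> D t = C \<and> (\<forall>i\<le>t. subalgebra (D i)) \<and>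
        (\<forall>i. 1 \<le> i \<and> i \<le> t \<longrightarrow> D i \<lhd> D (i - 1)))"

definition generated_subalgebra :: "'a set \<Rightarrow> 'a set \<Rightarrow> 'a set" where
  "generated_subalgebra B X = \<Inter>{S. subalgebra S \<and> S \<subseteq> B \<and> X \<subseteq> S}"

definition subinvariant_core :: "'a set \<Rightarrow> 'a set" where
  "subinvariant_core B = generated_subalgebra B (\<Union>{C. subinvariant C \<and> C \<subseteq> B})"

end

end

theory Submission imports Defs begin

text \<open>
  Let \<open>C \<subseteq> B\<close> be subinvariant. The decreasing sequence \<open>A\<close>, \<open>C \<bullet> A\<close>, \<open>C \<bullet> (C \<bullet> A)\<close>, \<dots> stabilises at
  some \<open>K \<subseteq> C\<close> that is a left ideal of \<open>A\<close>, so that \<open>C\<close> acts nilpotently on \<open>A / K\<close> from the left. In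
  characteristic zero a maximal ideal of \<open>H\<close> with this property is an ideal of every algebra in
  which \<open>H\<close> is an ideal. Climbing the chain from \<open>C\<close> to \<open>A\<close> therefore gives an ideal \<open>N\<close> of \<open>A\<close> that
  contains \<open>C\<close> and acts nilpotently on \<open>A / K\<close>. Every subalgebra of \<open>N\<close> containing \<open>K\<close> is
  subinvariant, in particular \<open>N \<inter> B\<close>, which is an ideal of \<open>B\<close> containing \<open>C\<close>. Hence the core of \<open>B\<close>
  is generated by ideals of \<open>B\<close>.
\<close>

locale leibniz_algebra_char_0 = leibniz_algebra scale mult
  for scale :: "'f::field_char_0 \<Rightarrow> 'a::ab_group_add \<Rightarrow> 'a" (infixr \<open>*s\<close> 75)
    and mult :: "'a \<Rightarrow> 'a \<Rightarrow> 'a" (infixl \<open>\<bullet>\<close> 70)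
begin

subsection \<open>Linear algebra\<close>

lemma mult_add_left: "(x + y) \<bullet> z = x \<bullet> z + y \<bullet> z"
  and mult_add_right: "x \<bullet> (y + z) = x \<bullet> y + x \<bullet> z"
  and mult_scale_left: "(r *s x) \<bullet> y = r *s (x \<bullet> y)"
  and mult_scale_right: "x \<bullet> (r *s y) = r *s (x \<bullet> y)"
  and mult_diff_left: "(x - y) \<bullet> z = x \<bullet> z - y \<bullet> z"
  and mult_diff_right: "x \<bullet> (y - z) = x \<bullet> y - x \<bullet> z"
  and mult_zero_left: "0 \<bullet> x = 0"
  and mult_zero_right: "x \<bullet> 0 = 0"
  using linear_left[unfolded linear_iff_module_hom, THEN module_hom.add]
    linear_right[unfolded linear_iff_module_hom, THEN module_hom.add]
    linear_left[unfolded linear_iff_module_hom, THEN module_hom.scale]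
    linear_right[unfolded linear_iff_module_hom, THEN module_hom.scale]
    linear_left[unfolded linear_iff_module_hom, THEN module_hom.diff]
    linear_right[unfolded linear_iff_module_hom, THEN module_hom.diff]
    linear_left[unfolded linear_iff_module_hom, THEN module_hom.zero]
    linear_right[unfolded linear_iff_module_hom, THEN module_hom.zero]
  by blast+

lemmas mult_simps = mult_add_left mult_add_right mult_scale_left mult_scale_right
  mult_diff_left mult_diff_right mult_zero_left mult_zero_right

text \<open>The Leibniz identity as L_(xy) = [L_x, L_y] for left multiplications L; it rewrites
  products into right-nested form.\<close>

lemma mult_assoc_left: "(x \<bullet> y) \<bullet> z = x \<bullet> (y \<bullet> z) - y \<bullet> (x \<bullet> z)"
  by (simp add: leibniz[of x y z])

lemma ex_finite_dimensional: "\<exists>X. finite_dimensional_vector_space scale X"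
proof -
  obtain X where X: "finite X" "span X = UNIV"
    using finite_dimensional by blast
  obtain Y where "Y \<subseteq> X" "independent Y" "X \<subseteq> span Y"
    using maximal_independent_subset by blast
  then have "finite_dimensional_vector_space scale Y"
    using X finite_subset span_mono[of X "span Y"]
    by unfold_locales (auto simp: span_span)
  then show ?thesis by blast
qed

lemma dim_bound: "\<exists>N. \<forall>S. dim S \<le> N"
proof -
  obtain X where X: "finite X" "span X = UNIV"
    using finite_dimensional by blast
  then show ?thesis
    using dim_le_card[of _ X] by blast
qed

lemma subspace_eq_if_dim_le:
  "subspace S \<Longrightarrow> subspace T \<Longrightarrow> S \<subseteq> T \<Longrightarrow> dim T \<le> dim S \<Longrightarrow> S = T"
  using ex_finite_dimensional finite_dimensional_vector_space.subspace_dim_equal by blast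

text \<open>Dimensions are bounded, so an M of greatest dimension serves and Zorn's lemma is
  avoided.\<close>

lemma maximal_subspace:
  assumes "P S0" and sub: "\<And>S. P S \<Longrightarrow> subspace S"
  obtains M where "P M" "\<And>S. P S \<Longrightarrow> M \<subseteq> S \<Longrightarrow> S = M"
proof -
  obtain N where "\<forall>S. dim S \<le> N"
    using dim_bound by blast
  then obtain M where M: "P M" "\<forall>S. P S \<longrightarrow> dim S \<le> dim M"
    using ex_has_greatest_nat[of P S0 dim "Suc N"] assms(1) by (auto simp: less_Suc_eq_le)
  show thesis
    by (rule that[of M]) (use M sub subspace_eq_if_dim_le in blast)+
qed

lemma decreasing_subspaces_stabilise:
  fixes G :: "nat \<Rightarrow> 'a set"
  assumes "\<And>n. subspace (G n)" "\<And>n. G (Suc n) \<subseteq> G n"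
  obtains n where "G (Suc n) = G n"
proof -
  obtain n where "\<forall>m. dim (G n) \<le> dim (G m)"
    using ex_has_least_nat[of "\<lambda>_. True" 0 "\<lambda>n. dim (G n)"] by auto
  then show thesis
    using that[of n] subspace_eq_if_dim_le[of "G (Suc n)" "G n"] assms by blast
qed

subsection \<open>Lower and upper series\<close>

text \<open>Two instances matter: \<open>U = UNIV\<close> shrinks to the residual K of C, and
  \<open>C = U = N\<close> is the lower central series of N, with index 0 for N itself.\<close>

fun lower_series :: "'a set \<Rightarrow> 'a set \<Rightarrow> nat \<Rightarrow> 'a set" where
  "lower_series C U 0 = U"
| "lower_series C U (Suc n) = span {c \<bullet> u | c u. c \<in> C \<and> u \<in> lower_series C U n}"

lemma subspace_lower_series: "subspace U \<Longrightarrow> subspace (lower_series C U n)"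
  by (cases n) auto

lemma lower_series_mult: "c \<in> C \<Longrightarrow> u \<in> lower_series C U n \<Longrightarrow> c \<bullet> u \<in> lower_series C U (Suc n)"
  by (auto intro!: span_base)

lemma lower_series_decreasing:
  assumes "subspace U" "\<And>c u. c \<in> C \<Longrightarrow> u \<in> U \<Longrightarrow> c \<bullet> u \<in> U"
  shows "lower_series C U (Suc n) \<subseteq> lower_series C U n"
proof (induction n)
  case 0
  have "{c \<bullet> u | c u. c \<in> C \<and> u \<in> U} \<subseteq> U"
    using assms(2) by blast
  then show ?case
    using assms(1) by (simp add: span_minimal)
next
  case (Suc n)
  then have "{c \<bullet> u | c u. c \<in> C \<and> u \<in> lower_series C U (Suc n)} \<subseteq> lower_series C U (Suc n)"
    using lower_series_mult by blast
  then show ?case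
    unfolding lower_series.simps(2)[of C U "Suc n"]
    by (rule span_minimal) simp
qed

text \<open>Induction on the left factor: (c u) y = c (u y) - u (c y) has the shorter left factor u
  in both terms. The \<open>Suc\<close> reflects that index i stands for the (i+1)-fold
  products.\<close>

lemma lower_series_mult_lower_series:
  assumes "x \<in> lower_series N N i" "y \<in> lower_series N N j" "subspace N"
  shows "x \<bullet> y \<in> lower_series N N (Suc (i + j))"
  using assms(1,2)
proof (induction i arbitrary: x y j)
  case 0
  then show ?case
    using lower_series_mult by simp
next
  case (Suc i)
  let ?S = "lower_series N N (Suc (Suc i + j))"
  have sub: "subspace ?S" by simp
  have "x \<in> span {c \<bullet> u | c u. c \<in> N \<and> u \<in> lower_series N N i}"
    using Suc.prems by simp
  then show ?case
  proof (induction rule: span_induct)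
    case base
    show ?case
      using sub unfolding subspace_def by (auto simp: mult_simps)
  next
    case (step z)
    then obtain c u where z: "z = c \<bullet> u" "c \<in> N" "u \<in> lower_series N N i"
      by blast
    have "c \<bullet> (u \<bullet> y) \<in> ?S"
      using lower_series_mult[OF z(2) Suc.IH[OF z(3) Suc.prems(2)]] by simp
    moreover have "u \<bullet> (c \<bullet> y) \<in> ?S"
      using Suc.IH[OF z(3) lower_series_mult[OF z(2) Suc.prems(2)]] by simp
    ultimately show ?case
      using sub z(1) mult_assoc_left subspace_diff by metis
  qed
qed

section \<open>Nilpotent left action modulo K\<close>

fun upper_series :: "'a set \<Rightarrow> 'a set \<Rightarrow> nat \<Rightarrow> 'a set" where
  "upper_series J K 0 = K"
| "upper_series J K (Suc n) = {v. \<forall>y\<in>J. y \<bullet> v \<in> upper_series J K n}"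

definition nil_modulo :: "'a set \<Rightarrow> 'a set \<Rightarrow> bool" where
  "nil_modulo K J \<longleftrightarrow> (\<exists>n. upper_series J K n = UNIV)"

definition left_ideal :: "'a set \<Rightarrow> bool" where
  "left_ideal K \<longleftrightarrow> subspace K \<and> (\<forall>x. \<forall>k\<in>K. x \<bullet> k \<in> K)"

lemma subspace_upper_series: "subspace K \<Longrightarrow> subspace (upper_series J K n)"
  by (induction n) (auto simp: subspace_def mult_simps)

lemma upper_series_increasing: "left_ideal K \<Longrightarrow> upper_series J K n \<subseteq> upper_series J K (Suc n)"
  by (induction n) (auto simp: left_ideal_def)

text \<open>In y (h v) = (y h) v + h (y v) the factor y h is again in J, so both terms descend one
  level.\<close>

lemma upper_series_stable:
  assumes "left_ideal K" "J \<lhd> H" "h \<in> H" "v \<in> upper_series J K n"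
  shows "h \<bullet> v \<in> upper_series J K n"
  using assms(4)
proof (induction n arbitrary: v)
  case 0
  then show ?case
    using assms(1) by (simp add: left_ideal_def)
next
  case (Suc n)
  have "y \<bullet> (h \<bullet> v) \<in> upper_series J K n" if y: "y \<in> J" for y
  proof -
    have "y \<bullet> h \<in> J"
      using y assms(2,3) by (auto simp: ideal_of_def)
    then have "(y \<bullet> h) \<bullet> v \<in> upper_series J K n" "h \<bullet> (y \<bullet> v) \<in> upper_series J K n"
      using Suc y by auto
    then show ?thesis
      using assms(1) leibniz[of y h v] subspace_upper_series[THEN subspace_add]
      by (simp add: left_ideal_def)
  qed
  then show ?case by simp
qed

definition left_word :: "'a list \<Rightarrow> 'a \<Rightarrow> 'a" where
  "left_word ys v = foldr (\<bullet>) ys v"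

lemma left_word_Nil [simp]: "left_word [] = (\<lambda>v. v)"
  and left_word_Cons [simp]: "left_word (y # ys) = (\<lambda>v. y \<bullet> left_word ys v)"
  and left_word_append: "left_word (xs @ ys) = (\<lambda>v. left_word xs (left_word ys v))"
  by (auto simp: left_word_def fun_eq_iff)

lemma mem_upper_series_iff:
  "v \<in> upper_series J K n \<longleftrightarrow> (\<forall>ys. set ys \<subseteq> J \<and> length ys = n \<longrightarrow> left_word ys v \<in> K)"
proof (induction n arbitrary: v)
  case 0
  then show ?case by simp
next
  case (Suc n)
  \<comment> \<open>The recursion of \<open>upper_series\<close> peels off the letter applied first,
    which is the last one of the list.\<close>
  have "(\<forall>ys. set ys \<subseteq> J \<and> length ys = Suc n \<longrightarrow> left_word ys v \<in> K) \<longleftrightarrow>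
    (\<forall>y ys. set (ys @ [y]) \<subseteq> J \<and> length ys = n \<longrightarrow> left_word (ys @ [y]) v \<in> K)"
    by (metis length_Suc_conv_rev length_append_singleton)
  then show ?case
    using Suc by (auto simp: left_word_append)
qed

subsection \<open>Derivations and words of left multiplications\<close>

text \<open>
  Linear combinations of words of left multiplications by \<open>H\<close> having at least \<open>r\<close> letters in \<open>J\<close>,
  up to maps into \<open>K\<close>.
\<close>

inductive word_span :: "'a set \<Rightarrow> 'a set \<Rightarrow> 'a set \<Rightarrow> nat \<Rightarrow> ('a \<Rightarrow> 'a) \<Rightarrow> bool" for K H J where
  into: "Vector_Spaces.linear scale scale T \<Longrightarrow> range T \<subseteq> K \<Longrightarrow> word_span K H J r T"
| ident: "word_span K H J 0 (\<lambda>v. v)"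
| letter: "word_span K H J r T \<Longrightarrow> h \<in> H \<Longrightarrow> word_span K H J r (\<lambda>v. h \<bullet> T v)"
| ideal_letter: "word_span K H J r T \<Longrightarrow> y \<in> J \<Longrightarrow> word_span K H J (Suc r) (\<lambda>v. y \<bullet> T v)"
| add: "word_span K H J r T \<Longrightarrow> word_span K H J r U \<Longrightarrow> word_span K H J r (\<lambda>v. T v + U v)"
| scale: "word_span K H J r T \<Longrightarrow> word_span K H J r (\<lambda>v. c *s T v)"
| Suc: "word_span K H J (Suc r) T \<Longrightarrow> word_span K H J r T"

lemma linear_selfI:
  "(\<And>x y. T (x + y) = T x + T y) \<Longrightarrow> (\<And>c x. T (c *s x) = c *s T x) \<Longrightarrow>
    Vector_Spaces.linear scale scale T"
  by (simp add: Vector_Spaces.linear_iff vector_space_axioms)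

lemma linear_selfD:
  assumes "Vector_Spaces.linear scale scale T"
  shows "T (x + y) = T x + T y" "T (c *s x) = c *s T x" "T (x - y) = T x - T y" "T 0 = 0"
  using assms by (simp_all add: module_hom.add module_hom.scale module_hom.diff module_hom.zero
      linear_iff_module_hom)

lemma word_span_linear: "word_span K H J r T \<Longrightarrow> Vector_Spaces.linear scale scale T"
  by (induction rule: word_span.induct)
    (auto intro!: linear_selfI simp: linear_selfD mult_simps scale_right_distrib scale_left_commute)

lemma word_span_diff:
  assumes "word_span K H J r T" "word_span K H J r U"
  shows "word_span K H J r (\<lambda>v. T v - U v)"
  using word_span.add[OF assms(1) word_span.scale[OF assms(2), of "-1"]] by simp

lemma word_span_zero: "subspace K \<Longrightarrow> word_span K H J r (\<lambda>v. 0)"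
  by (rule word_span.into) (auto intro!: linear_selfI simp: subspace_0)

lemma word_span_mono: "word_span K H J r T \<Longrightarrow> s \<le> r \<Longrightarrow> word_span K H J s T"
  by (rotate_tac, induction rule: inc_induct) (auto intro: word_span.Suc)

lemma word_span_comp:
  assumes "word_span K H J r T" "word_span K H J s U"
  shows "word_span K H J (r + s) (\<lambda>v. T (U v))"
  using assms
proof (induction rule: word_span.induct)
  case (into T r)
  then show ?case
    using word_span_linear[OF into(3)]
    by (intro word_span.into) (auto intro!: linear_selfI simp: linear_selfD)
next
  case (Suc r T)
  then show ?case
    using word_span.Suc[of K H J "r + s"] by simp
qed (simp_all add: word_span.letter word_span.ideal_letter word_span.add word_span.scale)

text \<open>Letters in H preserve every level and each letter in J descends one. Level 0 is K, which
  absorbs all further letters.\<close>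

lemma word_span_maps_upper_series:
  assumes "word_span K H J r T" "left_ideal K" "J \<lhd> H" "v \<in> upper_series J K n"
  shows "T v \<in> upper_series J K (n - r)"
  using assms(1,4)
proof (induction arbitrary: v rule: word_span.induct)
  case (into T r)
  have "K \<subseteq> upper_series J K m" for m
    using lift_Suc_mono_le[of "upper_series J K" 0 m] upper_series_increasing[OF assms(2)] by simp
  then show ?case
    using into by blast
next
  case (letter r T h)
  then show ?case
    using upper_series_stable assms by blast
next
  case (ideal_letter r T y)
  then have Tv: "T v \<in> upper_series J K (n - r)" by blast
  show ?case
  proof (cases "n - r")
    case 0
    then show ?thesis
      using Tv assms(2) by (simp add: left_ideal_def)
  next
    case (Suc m)
    then have "n - Suc r = m" by simp
    then show ?thesis
      using Tv Suc ideal_letter(2) by simp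
  qed
next
  case (Suc r T)
  show ?case
  proof (cases "n - r")
    case 0
    then show ?thesis
      using Suc.IH[OF Suc.prems] by simp
  next
    case (Suc m)
    then have "n - r = Suc (n - Suc r)" by simp
    then show ?thesis
      using Suc.IH[OF Suc.prems] upper_series_increasing[OF assms(2), of J "n - Suc r"] by auto
  qed
qed (use assms(2) in \<open>auto simp: left_ideal_def subspace_upper_series subspace_add subspace_scale\<close>)

text \<open>The commutator [L_a, T], an inner derivation of the endomorphism algebra; it sends L_y
  to L_(ay).\<close>

definition bracket :: "'a \<Rightarrow> ('a \<Rightarrow> 'a) \<Rightarrow> 'a \<Rightarrow> 'a" where
  "bracket a T = (\<lambda>v. a \<bullet> T v - T (a \<bullet> v))"

lemma bracket_mult: "bracket a (\<lambda>v. y \<bullet> T v) = (\<lambda>v. (a \<bullet> y) \<bullet> T v + y \<bullet> bracket a T v)"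
  by (auto simp: bracket_def fun_eq_iff mult_simps mult_assoc_left)

lemma bracket_add: "bracket a (\<lambda>v. T v + U v) = (\<lambda>v. bracket a T v + bracket a U v)"
  and bracket_scale: "bracket a (\<lambda>v. c *s T v) = (\<lambda>v. c *s bracket a T v)"
  by (auto simp: bracket_def fun_eq_iff mult_simps scale_right_diff_distrib)

lemma bracket_linear_into:
  assumes "Vector_Spaces.linear scale scale T" "range T \<subseteq> K" "left_ideal K"
  shows "Vector_Spaces.linear scale scale (bracket a T)" "range (bracket a T) \<subseteq> K"
proof -
  show "Vector_Spaces.linear scale scale (bracket a T)"
    using assms(1)
    by (auto intro!: linear_selfI simp: linear_selfD bracket_def mult_simps scale_right_diff_distrib)
  have "T v \<in> K" for v
    using assms(2) by blast
  then show "range (bracket a T) \<subseteq> K"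
    using assms(3) by (auto simp: bracket_def left_ideal_def intro!: subspace_diff)
qed

text \<open>By the product rule each term differentiates one letter. A letter of J may leave J but
  stays in H, so at most one letter in J is lost.\<close>

lemma word_span_bracket:
  assumes "word_span K H J r T" "left_ideal K" "\<And>h. h \<in> H \<Longrightarrow> a \<bullet> h \<in> H" "J \<subseteq> H"
  shows "word_span K H J (r - 1) (bracket a T)"
  using assms(1)
proof (induction rule: word_span.induct)
  case (into T r)
  then show ?case
    using bracket_linear_into assms(2) by (intro word_span.into) auto
next
  case ident
  have "bracket a (\<lambda>v. v) = (\<lambda>v. 0)"
    by (auto simp: bracket_def)
  then show ?case
    using word_span_zero assms(2) by (simp add: left_ideal_def)
next
  case (letter r T h)
  then show ?case
    using assms(3) word_span_mono[of K H J r T "r - 1"]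
    by (auto simp: bracket_mult intro!: word_span.add word_span.letter)
next
  case (ideal_letter r T y)
  \<comment> \<open>The subtraction is truncated: the index is 1 for r = 0 and r otherwise, hence
    always at least r.\<close>
  have "word_span K H J (Suc (r - 1)) (\<lambda>v. y \<bullet> bracket a T v)"
    using ideal_letter by (auto intro: word_span.ideal_letter)
  then have "word_span K H J r (\<lambda>v. y \<bullet> bracket a T v)"
    by (rule word_span_mono) simp
  then show ?case
    using ideal_letter assms(3,4) by (auto simp: bracket_mult intro!: word_span.add word_span.letter)
next
  case (Suc r T)
  then show ?case
    by (auto intro: word_span_mono)
qed (auto simp: bracket_add bracket_scale intro: word_span.add word_span.scale)

context
  fixes K H J :: "'a set" and a :: 'a
  assumes K: "left_ideal K" and JH: "J \<lhd> H" and aH: "\<And>h. h \<in> H \<Longrightarrow> a \<bullet> h \<in> H"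
begin

lemma ideal_subset: "J \<subseteq> H"
  using JH by (simp add: ideal_of_def)

lemma word_span_bracket_pow:
  "word_span K H J r T \<Longrightarrow> word_span K H J (r - k) ((bracket a ^^ k) T)"
proof (induction k)
  case (Suc k)
  then show ?case
    using word_span_bracket[OF Suc.IH[OF Suc.prems] K aH ideal_subset] by simp
qed simp

lemma word_span_left_word: "set ys \<subseteq> J \<Longrightarrow> word_span K H J (length ys) (left_word ys)"
  by (induction ys) (simp_all add: word_span.ident word_span.ideal_letter)

text \<open>
  The binomial expansion of the \<open>k\<close>-th power of the derivation applied to a product; all terms with
  \<open>k\<close> or \<open>k - 1\<close> derivatives on \<open>T\<close> are split off. For \<open>k = 0\<close> the truncated \<open>k - 1\<close> is harmless, since
  its coefficient vanishes.
\<close>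

lemma bracket_pow_product:
  assumes "word_span K H J m T" "y \<in> J"
  shows "word_span K H J (Suc (Suc m) - k)
    (\<lambda>v. (bracket a ^^ k) (\<lambda>v. y \<bullet> T v) v - y \<bullet> (bracket a ^^ k) T v
       - of_nat k *s ((a \<bullet> y) \<bullet> (bracket a ^^ (k - 1)) T v))"
proof (induction k)
  case 0
  then show ?case
    using K by (simp add: word_span_zero left_ideal_def)
next
  case (Suc k)
  let ?D = "bracket a"
  let ?E = "\<lambda>v. (?D ^^ k) (\<lambda>v. y \<bullet> T v) v - y \<bullet> (?D ^^ k) T v
       - of_nat k *s ((a \<bullet> y) \<bullet> (?D ^^ (k - 1)) T v)"
  have ay: "a \<bullet> (a \<bullet> y) \<in> H"
    using aH ideal_subset assms(2) by blast
  have 1: "word_span K H J (Suc (Suc m) - Suc k) (?D ?E)"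
    using word_span_bracket[OF Suc.IH K aH ideal_subset, simplified diff_diff_left] by simp
  \<comment> \<open>This cross term appears when the factor a y is differentiated again. For k > 0
    its count m - (k - 1) is exactly the required one.\<close>
  have 2: "word_span K H J (Suc (Suc m) - Suc k)
      (\<lambda>v. of_nat k *s ((a \<bullet> (a \<bullet> y)) \<bullet> (?D ^^ (k - 1)) T v))"
  proof (cases k)
    case 0
    then show ?thesis
      using K by (simp add: word_span_zero left_ideal_def)
  next
    case (Suc j)
    have "word_span K H J (m - (k - 1)) ((?D ^^ (k - 1)) T)"
      by (rule word_span_bracket_pow[OF assms(1)])
    then show ?thesis
      using ay Suc by (auto intro!: word_span.scale word_span.letter)
  qed
  have kD: "?D ((?D ^^ (k - Suc 0)) T) = (?D ^^ k) T" if "0 < k"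
    using that by (cases k) auto
  have "?D ?E = (\<lambda>v. ?D ((?D ^^ k) (\<lambda>v. y \<bullet> T v)) v - ?D (\<lambda>v. y \<bullet> (?D ^^ k) T v) v
       - of_nat k *s ?D (\<lambda>v. (a \<bullet> y) \<bullet> (?D ^^ (k - 1)) T v) v)"
    by (auto simp: bracket_def fun_eq_iff mult_simps scale_right_diff_distrib)
  also have "\<dots> = (\<lambda>v. (?D ^^ Suc k) (\<lambda>v. y \<bullet> T v) v - y \<bullet> (?D ^^ Suc k) T v
       - of_nat (Suc k) *s ((a \<bullet> y) \<bullet> (?D ^^ k) T v)
       - of_nat k *s ((a \<bullet> (a \<bullet> y)) \<bullet> (?D ^^ (k - 1)) T v))"
    by (auto simp: bracket_mult fun_eq_iff scale_right_distrib scale_left_distrib kD)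
  finally show ?case
    using word_span.add[OF 1 2] by simp
qed

text \<open>Distribute n derivatives over n letters. In n! ways every letter receives exactly one;
  in all other terms some letter receives none and stays in J.\<close>

lemma bracket_pow_left_word:
  assumes "set ys \<subseteq> J"
  shows "word_span K H J 1
    (\<lambda>v. (bracket a ^^ length ys) (left_word ys) v - fact (length ys) *s left_word (map ((\<bullet>) a) ys) v)"
  using assms
proof (induction ys)
  case Nil
  then show ?case
    using K by (simp add: word_span_zero left_ideal_def)
next
  case (Cons y ys)
  let ?m = "length ys" and ?T = "left_word ys" and ?D = "bracket a"
  let ?E = "left_word (map ((\<bullet>) a) ys)"
  have y: "y \<in> J" "a \<bullet> y \<in> H" and ys: "set ys \<subseteq> J"
    using Cons.prems aH ideal_subset by auto
  note T = word_span_left_word[OF ys]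
  have 1: "word_span K H J 1 (\<lambda>v. (?D ^^ Suc ?m) (\<lambda>v. y \<bullet> ?T v) v - y \<bullet> (?D ^^ Suc ?m) ?T v
       - of_nat (Suc ?m) *s ((a \<bullet> y) \<bullet> (?D ^^ ?m) ?T v))"
    using bracket_pow_product[OF T y(1), of "Suc ?m"] by simp
  \<comment> \<open>All derivatives fall on the tail, so the first letter y remains in J.\<close>
  have 2: "word_span K H J 1 (\<lambda>v. y \<bullet> (?D ^^ Suc ?m) ?T v)"
    using word_span.ideal_letter[OF word_span_bracket_pow[OF T, of "Suc ?m"] y(1)] by simp
  \<comment> \<open>One derivative falls on y. The coefficient m + 1 turns the m! of the induction
    hypothesis into (m + 1)!.\<close>
  have 3: "word_span K H J 1 (\<lambda>v. of_nat (Suc ?m) *s ((a \<bullet> y) \<bullet>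
      ((?D ^^ ?m) ?T v - fact ?m *s ?E v)))"
    by (intro word_span.scale word_span.letter Cons.IH ys y)
  have "(\<lambda>v. (?D ^^ length (y # ys)) (left_word (y # ys)) v
      - fact (length (y # ys)) *s left_word (map ((\<bullet>) a) (y # ys)) v) =
    (\<lambda>v. ((?D ^^ Suc ?m) (\<lambda>v. y \<bullet> ?T v) v - y \<bullet> (?D ^^ Suc ?m) ?T v
       - of_nat (Suc ?m) *s ((a \<bullet> y) \<bullet> (?D ^^ ?m) ?T v)) + y \<bullet> (?D ^^ Suc ?m) ?T v
      + of_nat (Suc ?m) *s ((a \<bullet> y) \<bullet> ((?D ^^ ?m) ?T v - fact ?m *s ?E v)))"
    by (simp add: fun_eq_iff mult_simps scale_right_diff_distrib del: funpow.simps of_nat_Suc)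
  then show ?case
    using word_span.add[OF word_span.add[OF 1 2] 3] by simp
qed

text \<open>
  The \<open>n\<close>-th derivative of a word of length \<open>n\<close> in \<open>J\<close> still maps into \<open>K\<close>. Characteristic zero enters
  here, in the division by \<open>n!\<close>.
\<close>

lemma left_word_derived_letters:
  assumes "upper_series J K n = UNIV" "set ys \<subseteq> J" "length ys = n"
  shows "word_span K H J 1 (left_word (map ((\<bullet>) a) ys))"
proof -
  let ?D = "bracket a" and ?E = "left_word (map ((\<bullet>) a) ys)"
  have "range (left_word ys) \<subseteq> K"
    using assms mem_upper_series_iff by blast
  then have "Vector_Spaces.linear scale scale ((?D ^^ k) (left_word ys)) \<and>
      range ((?D ^^ k) (left_word ys)) \<subseteq> K" for k
    using word_span_linear[OF word_span_left_word[OF assms(2)]]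
    by (induction k) (simp_all add: bracket_linear_into[OF _ _ K])
  then have "word_span K H J 1 ((?D ^^ n) (left_word ys))"
    by (auto intro: word_span.into)
  from word_span.scale[OF word_span_diff[OF this bracket_pow_left_word[OF assms(2)]],
      of "inverse (fact n)"]
  show ?thesis
    using assms(3) by simp
qed

text \<open>
  A word of length \<open>n\<close> in the enlarged ideal can be rewritten with at least one letter in \<open>J\<close>, so a
  word of length \<open>n * n\<close> can be rewritten with at least \<open>n\<close> such letters.
\<close>

lemma nil_modulo_add_derived:
  assumes "nil_modulo K J"
  shows "nil_modulo K {y + a \<bullet> z | y z. y \<in> J \<and> z \<in> J}" (is "nil_modulo K ?J'")
proof -
  obtain n where n: "upper_series J K n = UNIV"
    using assms by (auto simp: nil_modulo_def)
  have sub: "subspace J" "subspace H"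
    using JH by (auto simp: ideal_of_def subalgebra_def)
  have J'H: "?J' \<subseteq> H"
    using ideal_subset aH sub by (auto intro: subspace_add)
  have word: "word_span K H J 0 (left_word xs)" if "set xs \<subseteq> H" for xs
    using that by (induction xs) (simp_all add: word_span.ident word_span.letter)
  \<comment> \<open>Expand every letter as y + a z. Terms containing some y already have a letter in
    J; only the word with all letters a z is left over.\<close>
  have mixed: "\<exists>ys. set ys \<subseteq> J \<and> length ys = length xs \<and>
      word_span K H J 1 (\<lambda>v. left_word xs v - left_word (map ((\<bullet>) a) ys) v)"
    if "set xs \<subseteq> ?J'" for xs
    using that
  proof (induction xs)
    case Nil
    then show ?case
      using K by (auto simp: word_span_zero left_ideal_def)
  next
    case (Cons x xs)
    then obtain ys where ys: "set ys \<subseteq> J" "length ys = length xs"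
      "word_span K H J 1 (\<lambda>v. left_word xs v - left_word (map ((\<bullet>) a) ys) v)"
      by auto
    obtain y z where x: "x = y + a \<bullet> z" "y \<in> J" "z \<in> J"
      using Cons.prems by auto
    have "word_span K H J 1 (\<lambda>v. y \<bullet> left_word xs v)"
      using word_span.ideal_letter[OF word x(2)] Cons.prems J'H by auto
    moreover have "word_span K H J 1
        (\<lambda>v. (a \<bullet> z) \<bullet> (left_word xs v - left_word (map ((\<bullet>) a) ys) v))"
      by (rule word_span.letter[OF ys(3)]) (use aH ideal_subset x(3) in blast)
    ultimately have "word_span K H J 1 (\<lambda>v. y \<bullet> left_word xs v +
        (a \<bullet> z) \<bullet> (left_word xs v - left_word (map ((\<bullet>) a) ys) v))"
      by (rule word_span.add)
    then show ?case
      using ys x by (intro exI[of _ "z # ys"])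
        (simp add: mult_add_left mult_diff_right add_diff_eq)
  qed
  have block: "word_span K H J 1 (left_word xs)" if xs: "set xs \<subseteq> ?J'" "length xs = n" for xs
  proof -
    obtain ys where ys: "set ys \<subseteq> J" "length ys = length xs"
      "word_span K H J 1 (\<lambda>v. left_word xs v - left_word (map ((\<bullet>) a) ys) v)"
      using mixed[OF xs(1)] by blast
    have "word_span K H J 1 (left_word (map ((\<bullet>) a) ys))"
      using left_word_derived_letters n ys xs by simp
    from word_span.add[OF ys(3) this] show ?thesis by simp
  qed
  have blocks: "word_span K H J k (left_word xs)" if "set xs \<subseteq> ?J'" "length xs = k * n" for xs k
    using that
  proof (induction k arbitrary: xs)
    case 0
    then show ?case
      by (auto intro: word_span.ident)
  next
    case (Suc k)
    have "word_span K H J 1 (left_word (take n xs))" "word_span K H J k (left_word (drop n xs))"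
      by (rule block Suc.IH; use Suc.prems set_take_subset[of n xs] set_drop_subset[of n xs] in auto)+
    from word_span_comp[OF this] show ?case
      using left_word_append[of "take n xs" "drop n xs"] by simp
  qed
  have "left_word xs v \<in> K" if "set xs \<subseteq> ?J'" "length xs = n * n" for xs v
    using word_span_maps_upper_series[OF blocks[OF that] K JH, of v n] n by simp
  then have "upper_series ?J' K (n * n) = UNIV"
    using mem_upper_series_iff by blast
  then show ?thesis
    by (auto simp: nil_modulo_def)
qed

end

subsection \<open>Nil ideals\<close>

lemma left_annihilator_mult:
  assumes "\<And>v. z \<bullet> v = 0"
  shows "(x \<bullet> z) \<bullet> v = 0"
  using assms by (simp add: mult_assoc_left mult_zero_right)

text \<open>[L_x, L_y] + [L_y, L_x] = 0. This substitute for anticommutativity later turns left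
  stability into right stability.\<close>

lemma left_annihilator_symmetrized: "(x \<bullet> y + y \<bullet> x) \<bullet> v = 0"
  by (simp add: mult_add_left mult_assoc_left)

text \<open>Since a h and h a lie in H, the products (a z) h and h (a z) differ from a (z h) and a
  (h z) only by elements of M.\<close>

lemma ideal_add_derived:
  assumes "M \<lhd> H" "H \<lhd> G" "a \<in> G"
  shows "{y + a \<bullet> z | y z. y \<in> M \<and> z \<in> M} \<lhd> H" (is "?M' \<lhd> H")
proof -
  have subM: "subspace M" and MH: "M \<subseteq> H"
    and M: "\<And>x y. x \<in> M \<Longrightarrow> y \<in> H \<Longrightarrow> x \<bullet> y \<in> M" "\<And>x y. x \<in> M \<Longrightarrow> y \<in> H \<Longrightarrow> y \<bullet> x \<in> M"
    and H: "subalgebra H" "subspace H"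
    and aH: "\<And>x. x \<in> H \<Longrightarrow> a \<bullet> x \<in> H" "\<And>x. x \<in> H \<Longrightarrow> x \<bullet> a \<in> H"
    using assms by (auto simp: ideal_of_def subalgebra_def)
  have "subspace ?M'"
  proof (rule subspaceI)
    show "0 \<in> ?M'"
      using subspace_0[OF subM] mult_zero_right by force
  next
    fix u w
    assume "u \<in> ?M'" "w \<in> ?M'"
    then obtain y z y' z' where "u = y + a \<bullet> z" "w = y' + a \<bullet> z'" "y \<in> M" "z \<in> M" "y' \<in> M" "z' \<in> M"
      by blast
    moreover from this have "u + w = (y + y') + a \<bullet> (z + z')"
      by (simp add: mult_add_right algebra_simps)
    ultimately show "u + w \<in> ?M'"
      using subspace_add[OF subM] by blast
  next
    fix c u
    assume "u \<in> ?M'"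
    then obtain y z where "u = y + a \<bullet> z" "y \<in> M" "z \<in> M"
      by blast
    moreover from this have "c *s u = c *s y + a \<bullet> (c *s z)"
      by (simp add: mult_scale_right scale_right_distrib)
    ultimately show "c *s u \<in> ?M'"
      using subspace_scale[OF subM] by blast
  qed
  moreover have "?M' \<subseteq> H"
    using MH aH H by (auto intro!: subspace_add)
  moreover have "x \<bullet> h \<in> ?M' \<and> h \<bullet> x \<in> ?M'" if x0: "x \<in> ?M'" and h: "h \<in> H" for x h
  proof -
    obtain y z where x: "x = y + a \<bullet> z" "y \<in> M" "z \<in> M"
      using x0 by blast
    have "x \<bullet> h = (y \<bullet> h - z \<bullet> (a \<bullet> h)) + a \<bullet> (z \<bullet> h)"
      using x by (simp add: mult_simps mult_assoc_left)
    moreover have "h \<bullet> x = (h \<bullet> y + (h \<bullet> a) \<bullet> z) + a \<bullet> (h \<bullet> z)"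
      using x by (simp add: mult_simps leibniz[of h a z])
    moreover have "y \<bullet> h - z \<bullet> (a \<bullet> h) \<in> M" "h \<bullet> y + (h \<bullet> a) \<bullet> z \<in> M" "z \<bullet> h \<in> M" "h \<bullet> z \<in> M"
      using M x h aH by (auto intro!: subspace_add[OF subM] subspace_diff[OF subM])
    ultimately show ?thesis by blast
  qed
  ultimately show ?thesis
    using H by (simp add: ideal_of_def)
qed

text \<open>If z annihilates from the left, then z h = 0, and h z annihilates as well.\<close>

lemma ideal_add_left_annihilator:
  assumes "M \<lhd> H"
  shows "{y + z | y z. y \<in> M \<and> z \<in> H \<and> (\<forall>v. z \<bullet> v = 0)} \<lhd> H" (is "?M' \<lhd> H")
proof -
  have subM: "subspace M" and MH: "M \<subseteq> H"
    and M: "\<And>x y. x \<in> M \<Longrightarrow> y \<in> H \<Longrightarrow> x \<bullet> y \<in> M" "\<And>x y. x \<in> M \<Longrightarrow> y \<in> H \<Longrightarrow> y \<bullet> x \<in> M"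
    and H: "subalgebra H" "subspace H"
    using assms by (auto simp: ideal_of_def subalgebra_def)
  have "subspace {z \<in> H. \<forall>v. z \<bullet> v = 0}"
    using H by (auto simp: subspace_def mult_simps)
  from subspace_sums[OF subM this] have "subspace ?M'"
    by simp
  moreover have "?M' \<subseteq> H"
    using MH H by (auto intro!: subspace_add)
  moreover have "x \<bullet> h \<in> ?M' \<and> h \<bullet> x \<in> ?M'" if x0: "x \<in> ?M'" and h: "h \<in> H" for x h
  proof -
    obtain y z where x: "x = y + z" "y \<in> M" "z \<in> H" "\<forall>v. z \<bullet> v = 0"
      using x0 by blast
    have "x \<bullet> h = y \<bullet> h + 0" "h \<bullet> x = h \<bullet> y + h \<bullet> z"
      using x by (simp_all add: mult_simps)
    moreover have "0 \<in> H" "h \<bullet> z \<in> H" "\<forall>v. (h \<bullet> z) \<bullet> v = 0" "\<forall>v. 0 \<bullet> v = 0"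
      using H h x subspace_0 left_annihilator_mult
      by (auto simp: subalgebra_def mult_zero_left)
    ultimately show ?thesis
      using M[OF x(2) h] by blast
  qed
  ultimately show ?thesis
    using H by (simp add: ideal_of_def)
qed

text \<open>
  A maximal nil ideal of \<open>H\<close> absorbs the left annihilator of the algebra and is stable under the
  derivations of \<open>H\<close> induced by \<open>G\<close>.
\<close>

lemma nil_ideal_enlarge:
  assumes K: "left_ideal K" and "J \<lhd> H" "H \<lhd> G" "nil_modulo K J"
  obtains N where "N \<lhd> G" "J \<subseteq> N" "nil_modulo K N"
proof -
  let ?P = "\<lambda>S. S \<lhd> H \<and> J \<subseteq> S \<and> nil_modulo K S"
  have "?P J" "\<And>S. ?P S \<Longrightarrow> subspace S"
    using assms by (auto simp: ideal_of_def)
  then obtain M where "?P M" and max: "\<And>S. ?P S \<Longrightarrow> M \<subseteq> S \<Longrightarrow> S = M"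
    using maximal_subspace[of ?P J] by blast
  then have M: "M \<lhd> H" "J \<subseteq> M" "nil_modulo K M"
    by blast+
  have sub: "subspace M" "subspace H" and MH: "M \<subseteq> H"
    using M by (auto simp: ideal_of_def subalgebra_def)
  have HG: "\<And>g h. g \<in> G \<Longrightarrow> h \<in> H \<Longrightarrow> g \<bullet> h \<in> H \<and> h \<bullet> g \<in> H"
    using assms by (auto simp: ideal_of_def)
  have annihilator: "z \<in> M" if "z \<in> H" "\<forall>v. z \<bullet> v = 0" for z
  proof -
    let ?M' = "{y + z | y z. y \<in> M \<and> z \<in> H \<and> (\<forall>v. z \<bullet> v = 0)}"
    have MM': "M \<subseteq> ?M'"
      using subspace_0[OF sub(2)] mult_zero_left by force
    \<comment> \<open>The added elements act as zero from the left, so the nil condition is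
      unaffected.\<close>
    have "upper_series ?M' K n = upper_series M K n" for n
    proof (induction n)
      case (Suc n)
      have "(\<forall>y\<in>?M'. y \<bullet> v \<in> upper_series M K n) \<longleftrightarrow> (\<forall>y\<in>M. y \<bullet> v \<in> upper_series M K n)"
        (is "?L \<longleftrightarrow> ?R") for v
      proof
        show "?L \<Longrightarrow> ?R"
          using MM' by blast
        show "?R \<Longrightarrow> ?L"
          by (auto simp: mult_add_left)
      qed
      then show ?case
        by (simp only: upper_series.simps Suc)
    qed simp
    then have "?P ?M'"
      using ideal_add_left_annihilator[OF M(1)] M MM' by (simp add: nil_modulo_def subset_trans)
    then have "?M' = M"
      using max MM' by blast
    then show ?thesis
      using that subspace_0[OF sub(1)] by force
  qed
  have left: "a \<bullet> m \<in> M" if "a \<in> G" "m \<in> M" for a m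
  proof -
    let ?M' = "{y + a \<bullet> z | y z. y \<in> M \<and> z \<in> M}"
    have MM': "M \<subseteq> ?M'"
      using subspace_0[OF sub(1)] mult_zero_right by force
    have "?P ?M'"
      using nil_modulo_add_derived[OF K M(1) _ M(3), of a] ideal_add_derived[OF M(1) assms(3), of a]
        HG M MM' that by (simp add: subset_trans)
    then have "?M' = M"
      using max MM' by blast
    then show ?thesis
      using that subspace_0[OF sub(1)] by force
  qed
  \<comment> \<open>The element m a + a m lies in H and annihilates from the left, hence lies in M;
    subtract a m.\<close>
  have right: "m \<bullet> a \<in> M" if "a \<in> G" "m \<in> M" for a m
  proof -
    have "m \<bullet> a + a \<bullet> m \<in> M"
      using annihilator left_annihilator_symmetrized that HG MH subspace_add[OF sub(2)] by blast
    then show ?thesis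
      using subspace_diff[OF sub(1) _ left[OF that]] by fastforce
  qed
  have "M \<lhd> G"
    using left right sub MH assms(3) by (auto simp: ideal_of_def)
  then show thesis
    using that M by blast
qed

subsection \<open>Subinvariant subalgebras\<close>

lemma mult_span_mem:
  assumes "k \<in> span {c \<bullet> u | c u. c \<in> C \<and> u \<in> U}" "subspace S"
    and "\<And>c u. c \<in> C \<Longrightarrow> u \<in> U \<Longrightarrow> a \<bullet> (c \<bullet> u) \<in> S"
  shows "a \<bullet> k \<in> S"
  using assms(1)
proof (induction rule: span_induct)
  case base
  show ?case
    using assms(2) by (auto simp: subspace_def mult_simps)
next
  case (step x)
  then show ?case
    using assms(3) by blast
qed

text \<open>K is the stable term of A, C A, C (C A), ... with A the whole algebra. The i-th term
  lies in \<open>D i\<close>, because C is contained in the ideal \<open>D (Suc i)\<close> of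
  \<open>D i\<close>; the t-th one gives K inside C.\<close>

lemma subinvariant_residual:
  assumes D: "D 0 = UNIV" "D t = C" "\<And>i. i < t \<Longrightarrow> D (Suc i) \<lhd> D i" "subalgebra C"
  obtains K where "left_ideal K" "K \<subseteq> C" "nil_modulo K C"
proof -
  let ?G = "lower_series C UNIV"
  have G_sub: "subspace (?G r)" for r
    by (simp add: subspace_lower_series)
  have G_dec: "?G (Suc r) \<subseteq> ?G r" for r
    by (rule lower_series_decreasing) auto
  obtain n where n: "?G (Suc n) = ?G n"
    using decreasing_subspaces_stabilise[of ?G] G_sub G_dec by blast
  define K where "K = ?G n"
  have K_eq: "K = span {c \<bullet> u | c u. c \<in> C \<and> u \<in> K}"
    using n by (simp add: K_def)
  have KG: "K \<subseteq> ?G r" for r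
  proof (induction r)
    case (Suc r)
    then show ?case
      by (subst K_eq) (auto intro!: span_mono)
  qed simp
  have CD: "C \<subseteq> D i" if "i \<le> t" for i
    using that
  proof (induction rule: inc_induct)
    case (step i)
    then show ?case
      using D(3)[of i] by (auto simp: ideal_of_def)
  qed (simp add: D)
  have GD: "?G i \<subseteq> D i" if "i \<le> t" for i
    using that
  proof (induction i)
    case (Suc i)
    then have "D (Suc i) \<lhd> D i" "C \<subseteq> D (Suc i)" "?G i \<subseteq> D i"
      using D(3) CD by auto
    then have "{c \<bullet> u | c u. c \<in> C \<and> u \<in> ?G i} \<subseteq> D (Suc i)" "subspace (D (Suc i))"
      unfolding ideal_of_def by blast+
    then show ?case
      by (simp add: span_minimal)
  qed (simp add: D)
  have KC: "K \<subseteq> C"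
    using KG[of t] GD[of t] D by auto
  \<comment> \<open>Left stability of K is carried up the chain, from \<open>D t = C\<close> to
    \<open>D 0 = UNIV\<close>.\<close>
  have "\<forall>a\<in>D i. \<forall>k\<in>K. a \<bullet> k \<in> K" if "i \<le> t" for i
    using that
  proof (induction rule: inc_induct)
    case base
    show ?case
      using n lower_series_mult D(2) by (auto simp: K_def)
  next
    case (step i)
    \<comment> \<open>K is spanned by products c u with u in K, and a (c u) = (a c) u + c (a u). The
      first term is in K, as a c is in \<open>D (Suc i)\<close>; the second gains one level, so
      induction on r reaches the stable term.\<close>
    have "a \<bullet> k \<in> ?G r" if "a \<in> D i" "k \<in> K" for a k r
      using that(2)
    proof (induction r arbitrary: k)
      case (Suc r)
      show ?case
      proof (rule mult_span_mem[OF _ G_sub])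
        show "k \<in> span {c \<bullet> u | c u. c \<in> C \<and> u \<in> K}"
          using Suc.prems K_eq by blast
      next
        fix c u
        assume c: "c \<in> C" and uK: "u \<in> K"
        have "a \<bullet> c \<in> D (Suc i)"
          using D(3)[of i] step CD[of "Suc i"] c that(1) by (auto simp: ideal_of_def)
        then have "(a \<bullet> c) \<bullet> u \<in> ?G (Suc r)"
          using step.IH uK KG by blast
        moreover have "c \<bullet> (a \<bullet> u) \<in> ?G (Suc r)"
          using Suc.IH[OF uK] c lower_series_mult by blast
        ultimately show "a \<bullet> (c \<bullet> u) \<in> ?G (Suc r)"
          unfolding leibniz[of a c u] by (rule subspace_add[OF G_sub])
      qed
    qed simp
    then show ?case
      by (auto simp: K_def)
  qed
  then have "left_ideal K"
    using D(1) G_sub by (auto simp: left_ideal_def K_def)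
  \<comment> \<open>Applying j letters of C to \<open>?G (n - j)\<close> ends in
    \<open>?G n\<close>, which is K; j = n starts from the whole algebra.\<close>
  moreover have "?G (n - j) \<subseteq> upper_series C K j" if "j \<le> n" for j
    using that
  proof (induction j)
    case (Suc j)
    then have "n - j = Suc (n - Suc j)" by simp
    then show ?case
      using Suc lower_series_mult by fastforce
  qed (simp add: K_def)
  then have "nil_modulo K C"
    by (force simp: nil_modulo_def)
  ultimately show thesis
    using that KC by blast
qed

lemma subinvariant_chain:
  assumes "subinvariant C"
  shows "\<exists>D t. D 0 = UNIV \<and> D t = C \<and> (\<forall>i<t. D (Suc i) \<lhd> D i) \<and> subalgebra C"
proof -
  obtain t :: nat and D where D: "D 0 = UNIV \<and> D t = C \<and> (\<forall>i\<le>t. subalgebra (D i)) \<and>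
    (\<forall>i. 1 \<le> i \<and> i \<le> t \<longrightarrow> D i \<lhd> D (i - 1))"
    using assms unfolding subinvariant_def by (elim exE)
  have "D (Suc i) \<lhd> D i" if "i < t" for i
    using D that by (metis Suc_leI diff_Suc_1 le_add1 plus_1_eq_Suc)
  moreover have "subalgebra C"
    using D by blast
  ultimately show ?thesis
    using D by (intro exI[of _ D] exI[of _ t]) simp
qed

text \<open>Each step up the chain is one use of \<open>nil_ideal_enlarge\<close>, starting from C
  as an ideal of itself. K stays fixed throughout.\<close>

lemma subinvariant_subset_nil_ideal:
  assumes "subinvariant C"
  obtains K N where "left_ideal K" "K \<subseteq> C" "C \<subseteq> N" "N \<lhd> UNIV" "nil_modulo K N"
proof -
  obtain D t where "D 0 = UNIV \<and> D t = C \<and> (\<forall>i<t. D (Suc i) \<lhd> D i) \<and> subalgebra C"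
    using subinvariant_chain[OF assms] by (elim exE)
  then have D: "D 0 = UNIV" "D t = C" "\<And>i. i < t \<Longrightarrow> D (Suc i) \<lhd> D i" "subalgebra C"
    by simp_all
  obtain K where K: "left_ideal K" "K \<subseteq> C" "nil_modulo K C"
    by (rule subinvariant_residual[OF D])
  have "\<exists>J. J \<lhd> D i \<and> C \<subseteq> J \<and> nil_modulo K J" if "i \<le> t" for i
    using that
  proof (induction rule: inc_induct)
    case base
    show ?case
      using D K by (auto simp: ideal_of_def subalgebra_def)
  next
    case (step i)
    then obtain J where J: "J \<lhd> D (Suc i)" "C \<subseteq> J" "nil_modulo K J"
      by blast
    obtain N where "N \<lhd> D i" "J \<subseteq> N" "nil_modulo K N"
      using nil_ideal_enlarge[OF K(1) J(1) D(3)[OF step.hyps(2)] J(3)] .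
    then show ?case
      using J by blast
  qed
  from this[of 0] obtain N where "N \<lhd> UNIV" "C \<subseteq> N" "nil_modulo K N"
    using D(1) by auto
  then show thesis
    using that K by blast
qed

text \<open>The lower central series of N ends inside K, hence inside S. Adding S to its terms gives
  a chain from N down to S.\<close>

lemma subalgebra_of_nil_ideal_subinvariant:
  assumes K: "left_ideal K" "K \<subseteq> S" and S: "subalgebra S" "S \<subseteq> N"
    and N: "N \<lhd> UNIV" "nil_modulo K N"
  shows "subinvariant S"
proof -
  let ?P = "lower_series N N"
  have sub: "subspace S" "subspace N"
    using S N by (auto simp: subalgebra_def ideal_of_def)
  have NN: "\<And>x y. x \<in> N \<Longrightarrow> x \<bullet> y \<in> N \<and> y \<bullet> x \<in> N"
    using N by (auto simp: ideal_of_def)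
  have P_sub: "subspace (?P r)" for r
    using sub by (rule_tac subspace_lower_series)
  have P_dec: "?P (Suc r) \<subseteq> ?P r" for r
    using sub NN by (intro lower_series_decreasing) auto
  have PN: "?P r \<subseteq> N" for r
    using lift_Suc_antimono_le[of ?P 0 r] P_dec by simp
  obtain n where n: "upper_series N K n = UNIV"
    using N by (auto simp: nil_modulo_def)
  have "?P r \<subseteq> upper_series N K (n - r)" for r
  proof (induction r)
    case (Suc r)
    have "c \<bullet> u \<in> upper_series N K (n - Suc r)" if "c \<in> N" "u \<in> ?P r" for c u
    proof (cases "n - r")
      case 0
      then show ?thesis
        using Suc that K by (auto simp: left_ideal_def)
    next
      case (Suc m)
      then have "n - Suc r = m" by simp
      then show ?thesis
        using Suc Suc.IH that by auto
    qed
    then show ?case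
      using K subspace_upper_series unfolding lower_series.simps left_ideal_def
      by (intro span_minimal) blast+
  qed (simp add: n)
  from this[of n] have PnS: "?P n \<subseteq> S"
    using K by simp
  define E where "E r = {s + p | s p. s \<in> S \<and> p \<in> ?P r}" for r
  have E_sub: "subspace (E r)" for r
    unfolding E_def by (rule subspace_sums[OF sub(1) P_sub])
  have E_dec: "E (Suc r) \<subseteq> E r" for r
    using P_dec by (fastforce simp: E_def)
  have E_mult: "x \<bullet> y \<in> E (Suc r) \<and> y \<bullet> x \<in> E (Suc r)" if "x \<in> E r" "y \<in> E r" for x y r
  proof -
    have "x \<bullet> y \<in> E (Suc r)" if xy: "x \<in> E r" "y \<in> E r" for x y
    proof -
      obtain s p s' p' where x: "x = s + p" "s \<in> S" "p \<in> ?P r" and y: "y = s' + p'" "s' \<in> S" "p' \<in> ?P r"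
        using xy by (auto simp: E_def)
      have "x \<bullet> y = s \<bullet> s' + (s \<bullet> p' + (p \<bullet> s' + p \<bullet> p'))"
        using x y by (simp add: mult_simps)
      moreover have "s \<bullet> s' \<in> S"
        using S x y by (auto simp: subalgebra_def)
      moreover have "s \<bullet> p' \<in> ?P (Suc r)" "p \<bullet> p' \<in> ?P (Suc r)"
        using x y S PN lower_series_mult by blast+
      \<comment> \<open>Here the deep factor stands on the left, so the product rule for the lower
        series is needed, with s' at index 0.\<close>
      moreover have "p \<bullet> s' \<in> ?P (Suc r)"
        using lower_series_mult_lower_series[OF x(3), of s' 0] y S sub by auto
      ultimately show ?thesis
        unfolding E_def using subspace_add[OF P_sub[of "Suc r"]] by blast
    qed
    then show ?thesis
      using that by blast
  qed
  have E_alg: "subalgebra (E r)" for r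
    using E_sub E_mult E_dec by (fastforce simp: subalgebra_def)
  have E_ideal: "E (Suc r) \<lhd> E r" for r
    using E_sub E_alg E_mult E_dec by (fastforce simp: ideal_of_def)
  have E0: "E 0 = N"
  proof
    show "E 0 \<subseteq> N"
      using S sub by (auto simp: E_def intro!: subspace_add)
    show "N \<subseteq> E 0"
      using subspace_0[OF sub(1)] by (force simp: E_def)
  qed
  have En: "E n = S"
  proof
    show "E n \<subseteq> S"
      using PnS sub by (auto simp: E_def intro!: subspace_add)
    show "S \<subseteq> E n"
      using subspace_0[OF P_sub[of n]] by (force simp: E_def)
  qed
  \<comment> \<open>The whole algebra is put in front of \<open>E 0 = N\<close>, so S sits at index
    \<open>Suc n\<close>.\<close>
  define D where "D i = (case i of 0 \<Rightarrow> UNIV | Suc r \<Rightarrow> E r)" for i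
  have "D (Suc i) \<lhd> D i" for i
    using E_ideal E0 N by (cases i) (auto simp: D_def)
  then have "D i \<lhd> D (i - 1)" if "1 \<le> i" for i
    using that by (cases i) auto
  moreover have "subalgebra (D i)" for i
    using E_alg by (cases i) (auto simp: D_def subalgebra_def)
  moreover have "D 0 = UNIV" "D (Suc n) = S"
    using En by (auto simp: D_def)
  ultimately show ?thesis
    unfolding subinvariant_def by blast
qed

lemma subinvariant_subset_ideal:
  assumes "subalgebra B" "subinvariant C" "C \<subseteq> B"
  obtains S where "subinvariant S" "C \<subseteq> S" "S \<lhd> B"
proof -
  obtain K N where KN: "left_ideal K" "K \<subseteq> C" "C \<subseteq> N" "N \<lhd> UNIV" "nil_modulo K N"
    using subinvariant_subset_nil_ideal[OF assms(2)] .
  have alg: "subalgebra (N \<inter> B)" and NB: "N \<inter> B \<lhd> B"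
    using KN(4) assms(1) by (auto simp: subalgebra_def ideal_of_def intro: subspace_inter)
  have "K \<subseteq> N \<inter> B"
    using KN assms by blast
  then have "subinvariant (N \<inter> B)"
    using subalgebra_of_nil_ideal_subinvariant[OF KN(1) _ alg Int_lower1 KN(4,5)] by blast
  then show thesis
    using that[of "N \<inter> B"] NB KN(3) assms(3) by blast
qed

lemma subinvariant_core_ideal:
  assumes B: "subalgebra B"
  shows "subinvariant_core B \<lhd> B"
proof -
  let ?B = "subinvariant_core B"
  have alg: "subalgebra ?B" "?B \<subseteq> B"
    using B by (auto simp: subinvariant_core_def generated_subalgebra_def subalgebra_def
        intro!: subspace_Inter)
  have gen: "C \<subseteq> ?B" if "subinvariant C" "C \<subseteq> B" for C
    using that by (auto simp: subinvariant_core_def generated_subalgebra_def)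
  \<comment> \<open>T collects the elements of the core that B multiplies into the core from both
    sides. It is a subalgebra containing every generator, so it is the whole core.\<close>
  define T where "T = {b \<in> ?B. \<forall>x\<in>B. b \<bullet> x \<in> ?B \<and> x \<bullet> b \<in> ?B}"
  have sub: "subspace ?B"
    using alg by (simp add: subalgebra_def)
  have "subspace T"
    using sub unfolding T_def subspace_def by (auto simp: mult_simps)
  moreover have "b \<bullet> b' \<in> T" if b: "b \<in> T" "b' \<in> T" for b b'
  proof -
    have "(b \<bullet> b') \<bullet> x \<in> ?B" "x \<bullet> (b \<bullet> b') \<in> ?B" if "x \<in> B" for x
    proof -
      show "(b \<bullet> b') \<bullet> x \<in> ?B"
        unfolding mult_assoc_left
        using b that alg by (intro subspace_diff[OF sub]) (auto simp: T_def subalgebra_def)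
      show "x \<bullet> (b \<bullet> b') \<in> ?B"
        unfolding leibniz[of x b b']
        using b that alg by (intro subspace_add[OF sub]) (auto simp: T_def subalgebra_def)
    qed
    then show ?thesis
      using b alg by (auto simp: T_def subalgebra_def)
  qed
  ultimately have "subalgebra T"
    by (simp add: subalgebra_def)
  moreover have "C \<subseteq> T" if C: "subinvariant C" "C \<subseteq> B" for C
  proof -
    obtain S where S: "subinvariant S" "C \<subseteq> S" "S \<lhd> B"
      using subinvariant_subset_ideal[OF B C] .
    then have "S \<subseteq> ?B"
      using gen by (auto simp: ideal_of_def)
    then show ?thesis
      using S unfolding T_def ideal_of_def by blast
  qed
  moreover have "T \<subseteq> B"
    using alg by (auto simp: T_def)
  ultimately have "?B \<subseteq> T"
    unfolding subinvariant_core_def[of B] generated_subalgebra_def by blast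
  then show ?thesis
    using B sub alg unfolding ideal_of_def T_def by blast
qed

end

theorem corollary3p14:
  fixes scale :: "'f::field_char_0 \<Rightarrow> 'a::ab_group_add \<Rightarrow> 'a"
    and mult :: "'a \<Rightarrow> 'a \<Rightarrow> 'a"
    and B :: "'a set"
  assumes "leibniz_algebra scale mult"
    and "leibniz_algebra.subalgebra scale mult B"
  shows "leibniz_algebra.ideal_of scale mult
           (leibniz_algebra.subinvariant_core scale mult B) B"
proof -
  interpret leibniz_algebra_char_0 scale mult
    using assms(1) by (rule leibniz_algebra_char_0.intro)
  show ?thesis
    by (rule subinvariant_core_ideal[OF assms(2)])
qed

end
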